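(* Let $p$ be an odd prime with $p \equiv 3 \pmod 4$, let $k \geq 1$ be an integer, and let $t \in \mathbb{Z}_{p^k}$. If $t \neq 0$, write $t = p^{\alpha}\beta$ where $p \nmid \beta$ and $0 \le \alpha < k$. Then $$ N_{3}(t, p^k) = \begin{cases} p^{2k} + p^{2k-1} - p^{\lceil\frac{3k}{2}\rceil - 1} & \text{if } t = 0, \\ (p^{2k - 1} - p^{2k - \frac{\alpha + 3}{2}})(p+1) & \text{if } t\neq 0 \text{ and } \alpha \text{ is odd}, \\ p^{2k-1}(p+1) - 2p^{2k - 1-\frac{\alpha}{2}} & \text{if } t\neq 0,\ \alpha \text{ is even and } \left(\frac{\beta}{p}\right) = 1, \\ p^{2k-1}(p + 1) & \text{if } t\neq 0,\ \alpha \text{ is even and } \left(\frac{\beta}{p}\right) = -1. \end{cases} $$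
   Context: $\mathbb{Z}_n$ denotes the ring of integers modulo $n$. For $t \in \mathbb{Z}_n$, $N_3(t,n)$ is the number of ordered triples $(x_1,x_2,x_3) \in \mathbb{Z}_n^3$ with $x_1^2+x_2^2+x_3^2 \equiv t \pmod n$ (zero entries are allowed). In the factorization $t = p^{\alpha}\beta$ the element $t$ is represented by a nonzero integer in $\{1,\dots,p^k-1\}$. $\left(\frac{\cdot}{p}\right)$ is the Legendre symbol and $\lceil x\rceil$ is the ceiling of $x$. *)

theory Defs
  imports "HOL-Number_Theory.Number_Theory"
begin

text \<open>Elements of \<open>\<int>\<^sub>n\<close> are their least nonnegative integer representatives,
  which form the carrier of the library's \<open>residue_ring n\<close>.\<close>

definition N3 :: "int \<Rightarrow> nat \<Rightarrow> nat" where
  "N3 t n = card {(x1, x2, x3).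
     x1 \<in> carrier (residue_ring (int n)) \<and>
     x2 \<in> carrier (residue_ring (int n)) \<and>
     x3 \<in> carrier (residue_ring (int n)) \<and>
     [x1\<^sup>2 + x2\<^sup>2 + x3\<^sup>2 = t] (mod int n)}"

end

theory Submission
  imports Defs
begin

text \<open>Call a solution \<open>v\<close> of \<open>\<bar>v\<bar>\<^sup>2 = t\<close> modulo \<open>p\<^sup>k\<close> primitive if \<open>p\<close> does not divide all of its entries.

  Primitive solutions are smooth points of the quadric, so by Hensel's lemma each of them has exactly
  \<open>p\<^sup>2\<close> lifts from any power of \<open>p\<close> to the next (\<open>card_primitive_sols_lift\<close>). Their number is therefore
  \<open>p\<^bsup>2 (k - 1)\<^esup>\<close> times the number of primitive solutions modulo \<open>p\<close>. The latter number comes from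
  sums of two squares: since \<open>-1\<close> is not a square modulo \<open>p\<close>, the form \<open>y\<^sup>2 + z\<^sup>2\<close> is the norm form of
  the field with \<open>p\<^sup>2\<close> elements, so it takes the value \<open>0\<close> only at the origin and every nonzero value
  \<open>p + 1\<close> times (\<open>card_two_square_sols_unit\<close>). Summing over \<open>t - x\<^sup>2\<close> gives \<open>p\<^sup>2 - Legendre t p * p\<close>
  solutions modulo \<open>p\<close> (\<open>card_sols_prime\<close>).

  The other solutions have the form \<open>v = p * w\<close>. For \<open>k \<ge> 2\<close> they exist only if \<open>t = p\<^sup>2 * s\<close> modulo \<open>p\<^sup>k\<close>,
  and then \<open>w\<close>, a vector modulo \<open>p\<^bsup>k - 1\<^esup>\<close>, has to satisfy \<open>\<bar>w\<bar>\<^sup>2 = s\<close> modulo \<open>p\<^bsup>k - 2\<^esup>\<close>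
  (\<open>card_imprimitive_sols\<close>). With \<open>N k t\<close> for the number of all solutions, this is the recursion
  \<open>N k (p\<^sup>2 * s) = p\<^bsup>2 (k - 1)\<^esup> * (p\<^sup>2 - 1) + p\<^sup>3 * N (k - 2) s\<close> (\<open>card_sols_descent\<close>). It ends at a unit
  \<open>t\<close>, at a \<open>t\<close> divisible by \<open>p\<close> exactly once, or, for \<open>t = 0\<close>, at \<open>N 0 0 = 1\<close> or \<open>N 1 0 = p\<^sup>2\<close>. These
  starting points are the reason for the case distinctions by parity, and the factor \<open>p\<^sup>3\<close> for every
  second power of \<open>p\<close> produces the exponents \<open>3 k / 2\<close> and \<open>2 k - \<alpha> / 2\<close>.\<close>

section \<open>Lifting and descent of sums of three squares\<close>

text \<open>The representatives of \<open>(\<int> / n\<int>)\<^sup>3\<close>.\<close>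

definition box :: "int \<Rightarrow> (int \<times> int \<times> int) set" where
  "box n = {0..<n} \<times> {0..<n} \<times> {0..<n}"

lemma finite_box [simp]: "finite (box n)"
  by (simp add: box_def)

lemma card_box: "n \<ge> 0 \<Longrightarrow> int (card (box n)) = n ^ 3"
  by (simp add: box_def card_cartesian_product power3_eq_cube)

definition sum_sq :: "int \<times> int \<times> int \<Rightarrow> int" where
  "sum_sq = (\<lambda>(x, y, z). x\<^sup>2 + y\<^sup>2 + z\<^sup>2)"

definition dot :: "int \<times> int \<times> int \<Rightarrow> int \<times> int \<times> int \<Rightarrow> int" where
  "dot = (\<lambda>(x, y, z) (u, v, w). x * u + y * v + z * w)"

definition all_dvd :: "int \<Rightarrow> int \<times> int \<times> int \<Rightarrow> bool" where
  "all_dvd p = (\<lambda>(x, y, z). p dvd x \<and> p dvd y \<and> p dvd z)"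

definition add_scaled :: "int \<Rightarrow> int \<times> int \<times> int \<Rightarrow> int \<times> int \<times> int \<Rightarrow> int \<times> int \<times> int" where
  "add_scaled n = (\<lambda>(x, y, z) (u, v, w). (x + n * u, y + n * v, z + n * w))"

definition sols :: "int \<Rightarrow> int \<Rightarrow> (int \<times> int \<times> int) set" where
  "sols n t = {v \<in> box n. [sum_sq v = t] (mod n)}"

definition primitive_sols :: "int \<Rightarrow> int \<Rightarrow> int \<Rightarrow> (int \<times> int \<times> int) set" where
  "primitive_sols p n t = {v \<in> sols n t. \<not> all_dvd p v}"

lemma finite_sols [simp]: "finite (sols n t)" "finite (primitive_sols p n t)"
  by (simp_all add: sols_def primitive_sols_def)

lemma N3_eq_card_sols: "N3 t n = card (sols (int n) t)"
  unfolding N3_def sols_def box_def sum_sq_def residue_ring_def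
  by (intro arg_cong[where f = card]) auto

lemma sum_sq_add_scaled:
  "sum_sq (add_scaled n w u) = sum_sq w + 2 * n * dot w u + n\<^sup>2 * sum_sq u"
  by (cases w; cases u)
     (simp add: sum_sq_def add_scaled_def dot_def algebra_simps power2_eq_square)

lemma cong_sum_sq_add_scaled: "[sum_sq (add_scaled n w u) = sum_sq w] (mod n)"
proof -
  have "sum_sq (add_scaled n w u) - sum_sq w = n * (2 * dot w u + n * sum_sq u)"
    by (simp add: sum_sq_add_scaled algebra_simps power2_eq_square)
  then show ?thesis unfolding cong_iff_dvd_diff by simp
qed

lemma all_dvd_add_scaled: "p dvd n \<Longrightarrow> all_dvd p (add_scaled n w u) \<longleftrightarrow> all_dvd p w"
  by (cases w; cases u) (simp add: all_dvd_def add_scaled_def dvd_add_left_iff)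

lemma bij_betw_digits:
  assumes "n > 0" and "m > 0"
  shows "bij_betw (\<lambda>(w, u). add_scaled n w u) (box n \<times> box m) (box (n * m))"
proof (rule bij_betw_byWitness
    [where f' = "\<lambda>(x, y, z). ((x mod n, y mod n, z mod n), (x div n, y div n, z div n))"])
  have range: "0 \<le> x + n * u \<and> x + n * u < n * m"
    if "0 \<le> x" "x < n" "0 \<le> u" "u < m" for x u :: int
  proof -
    have "x + n * u < n * (u + 1)" using that by (simp add: algebra_simps)
    also have "\<dots> \<le> n * m" using that assms by (intro mult_left_mono) auto
    finally show ?thesis using that assms by simp
  qed
  then show "(\<lambda>(w, u). add_scaled n w u) ` (box n \<times> box m) \<subseteq> box (n * m)"
    by (auto simp: box_def add_scaled_def)
  have "x div n < m" if "x < n * m" for x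
  proof (rule ccontr)
    assume "\<not> x div n < m"
    then have "n * m \<le> n * (x div n)" using assms by simp
    also have "\<dots> \<le> x" using assms by (simp add: minus_mod_eq_mult_div[symmetric])
    finally show False using that by simp
  qed
  then show "(\<lambda>(x, y, z). ((x mod n, y mod n, z mod n), (x div n, y div n, z div n))) `
      box (n * m) \<subseteq> box n \<times> box m"
    using assms by (auto simp: box_def pos_imp_zdiv_nonneg_iff)
  show "\<forall>a\<in>box n \<times> box m. (\<lambda>(x, y, z). ((x mod n, y mod n, z mod n), x div n, y div n, z div n))
      ((\<lambda>(w, u). add_scaled n w u) a) = a"
    using assms by (auto simp: box_def add_scaled_def)
qed (auto simp: add_scaled_def)

text \<open>A vector modulo \<open>n * m\<close> is its residue \<open>w\<close> modulo \<open>n\<close> together with a leading digit \<open>u\<close>. Both the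
  lifting of primitive solutions and the descent for the others count along this fibration.\<close>

lemma card_box_mult:
  assumes "n > 0" and "m > 0"
  shows "card {v \<in> box (n * m). Q v} = (\<Sum>w\<in>box n. card {u \<in> box m. Q (add_scaled n w u)})"
proof -
  let ?f = "\<lambda>(w, u). add_scaled n w u"
  let ?S = "SIGMA w:box n. {u \<in> box m. Q (add_scaled n w u)}"
  have bij: "bij_betw ?f (box n \<times> box m) (box (n * m))" using assms by (rule bij_betw_digits)
  have "?f ` ?S = {v \<in> box (n * m). Q v}"
    using bij_betw_imp_surj_on[OF bij, symmetric] by auto
  moreover have "inj_on ?f ?S"
    using bij_betw_imp_inj_on[OF bij] by (rule inj_on_subset) auto
  ultimately have "card {v \<in> box (n * m). Q v} = card ?S" using card_image[of ?f ?S] by simp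
  then show ?thesis by (simp add: card_SigmaI)
qed

text \<open>Used to find the common size of the fibres of \<open>f\<close> modulo \<open>n\<close> once those are known to agree.\<close>

lemma card_eq_sum_residues:
  fixes n :: int
  assumes "finite A" and "n > 0"
  shows "card A = (\<Sum>d\<in>{0..<n}. card {x \<in> A. [f x = d] (mod n)})"
proof -
  have "card A = (\<Sum>d\<in>{0..<n}. \<Sum>x\<in>{x \<in> A. f x mod n = d}. 1)"
    using assms by (subst sum.group) auto
  also have "\<dots> = (\<Sum>d\<in>{0..<n}. card {x \<in> A. [f x = d] (mod n)})"
    by (intro sum.cong) (auto simp: cong_def intro!: arg_cong[where f = card])
  finally show ?thesis .
qed

lemma dot_unit:
  assumes "prime p" and "\<not> all_dvd p a"
  obtains e where "[dot a e = 1] (mod p)"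
proof -
  obtain x y z where a: "a = (x, y, z)" by (cases a)
  have inv: "\<exists>b. [c * b = 1] (mod p)" if "\<not> p dvd c" for c
    using assms(1) that by (metis prime_imp_coprime coprime_commute cong_solve_coprime_int)
  consider "\<not> p dvd x" | "\<not> p dvd y" | "\<not> p dvd z"
    using assms(2) by (auto simp: a all_dvd_def)
  then show ?thesis
  proof cases
    case 1
    then obtain b where "[x * b = 1] (mod p)" using inv by blast
    then show ?thesis by (intro that[of "(b, 0, 0)"]) (simp add: a dot_def)
  next
    case 2
    then obtain b where "[y * b = 1] (mod p)" using inv by blast
    then show ?thesis by (intro that[of "(0, b, 0)"]) (simp add: a dot_def)
  next
    case 3
    then obtain b where "[z * b = 1] (mod p)" using inv by blast
    then show ?thesis by (intro that[of "(0, 0, b)"]) (simp add: a dot_def)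
  qed
qed

text \<open>Translation by a multiple of a vector \<open>e\<close> with \<open>a \<bullet> e = 1\<close> maps any of the \<open>p\<close> planes
  \<open>a \<bullet> u = b\<close> injectively into any other, so they share the \<open>p\<^sup>3\<close> vectors equally.\<close>

lemma card_plane:
  assumes p: "prime p" and a: "\<not> all_dvd p a"
  shows "int (card {u \<in> box p. [dot a u = b] (mod p)}) = p\<^sup>2"
proof -
  define L where "L b = {u \<in> box p. [dot a u = b] (mod p)}" for b
  have p0: "p > 0" using p by (rule prime_gt_0_int)
  obtain e where e: "[dot a e = 1] (mod p)" using dot_unit[OF p a] .
  obtain a1 a2 a3 where a_eq: "a = (a1, a2, a3)" by (cases a)
  obtain e1 e2 e3 where e_eq: "e = (e1, e2, e3)" by (cases e)
  have le: "card (L b) \<le> card (L c)" for b c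
  proof (rule card_inj_on_le)
    let ?f = "\<lambda>(x, y, z). ((x + (c - b) * e1) mod p, (y + (c - b) * e2) mod p, (z + (c - b) * e3) mod p)"
    have inj: "x = u" if "(x + d) mod p = (u + d) mod p" "x \<in> {0..<p}" "u \<in> {0..<p}" for x u d
      using that cong_less_imp_eq_int[of x p u] cong_add_rcancel[of x d u p]
      by (auto simp: cong_def)
    show "inj_on ?f (L b)"
    proof (rule inj_onI, clarify)
      fix x y z u v w
      assume "(x, y, z) \<in> L b" "(u, v, w) \<in> L b"
        and "(x + (c - b) * e1) mod p = (u + (c - b) * e1) mod p"
          "(y + (c - b) * e2) mod p = (v + (c - b) * e2) mod p"
          "(z + (c - b) * e3) mod p = (w + (c - b) * e3) mod p"
      then show "x = u \<and> (y, z) = (v, w)"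
        using inj[of x "(c - b) * e1" u] inj[of y "(c - b) * e2" v] inj[of z "(c - b) * e3" w]
        by (simp add: L_def box_def)
    qed
    show "?f ` L b \<subseteq> L c"
    proof clarify
      fix x y z assume "(x, y, z) \<in> L b"
      then have xyz: "[a1 * x + a2 * y + a3 * z = b] (mod p)" by (simp add: L_def dot_def a_eq)
      have "[a1 * ((x + (c - b) * e1) mod p) + a2 * ((y + (c - b) * e2) mod p)
          + a3 * ((z + (c - b) * e3) mod p) =
          a1 * (x + (c - b) * e1) + a2 * (y + (c - b) * e2) + a3 * (z + (c - b) * e3)] (mod p)"
        by (intro cong_add cong_mult) auto
      also have "a1 * (x + (c - b) * e1) + a2 * (y + (c - b) * e2) + a3 * (z + (c - b) * e3) =
          (a1 * x + a2 * y + a3 * z) + (c - b) * (a1 * e1 + a2 * e2 + a3 * e3)"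
        by (simp add: algebra_simps)
      also have "[\<dots> = b + (c - b) * 1] (mod p)"
        using xyz e by (intro cong_add cong_mult) (auto simp: dot_def a_eq e_eq)
      finally show "((x + (c - b) * e1) mod p, (y + (c - b) * e2) mod p, (z + (c - b) * e3) mod p) \<in> L c"
        using p0 by (simp add: L_def box_def dot_def a_eq)
    qed
  qed (simp add: L_def)
  have "card (box p) = (\<Sum>d\<in>{0..<p}. card (L d))"
    unfolding L_def using p0 by (intro card_eq_sum_residues) auto
  also have "\<dots> = (\<Sum>d\<in>{0..<p}. card (L b))"
    using le by (intro sum.cong) (auto intro: le_antisym)
  finally have "int (card (box p)) = p * int (card (L b))" using p0 by simp
  then have "p * int (card (L b)) = p * p\<^sup>2"
    using p0 by (simp add: card_box power2_eq_square power3_eq_cube)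
  then show ?thesis using p0 by (simp add: L_def)
qed

text \<open>Hensel lifting. Writing \<open>\<bar>w\<bar>\<^sup>2 = t + n * m\<close>, the vector \<open>w + n * u\<close> solves the congruence
  modulo \<open>n * p\<close> exactly if \<open>2 * (w \<bullet> u) = - m\<close> modulo \<open>p\<close>: the quadratic term in \<open>u\<close> carries the
  factor \<open>n\<^sup>2\<close>, a multiple of \<open>n * p\<close>. As \<open>2 * w\<close> is nonzero modulo \<open>p\<close>, the lifts of a primitive
  solution \<open>w\<close> form a plane.\<close>

lemma card_primitive_sols_lift:
  assumes p: "prime p" and odd: "\<not> p dvd 2" and "n > 0" and "p dvd n"
  shows "int (card (primitive_sols p (n * p) t)) = p\<^sup>2 * int (card (primitive_sols p n t))"
proof -
  have p0: "p > 0" using p by (rule prime_gt_0_int)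
  have fibre: "int (card {u \<in> box p. [sum_sq (add_scaled n w u) = t] (mod n * p) \<and>
      \<not> all_dvd p (add_scaled n w u)}) = (if w \<in> primitive_sols p n t then p\<^sup>2 else 0)"
    (is "int (card ?F) = _") if w: "w \<in> box n" for w
  proof (cases "w \<in> primitive_sols p n t")
    case True
    then have prim: "\<not> all_dvd p w" and "n dvd sum_sq w - t"
      by (auto simp: primitive_sols_def sols_def cong_iff_dvd_diff)
    then obtain m where m: "sum_sq w - t = n * m" by blast
    obtain a1 a2 a3 where w_eq: "w = (a1, a2, a3)" by (cases w)
    let ?a = "(2 * a1, 2 * a2, 2 * a3)"
    have "[sum_sq (add_scaled n w u) = t] (mod n * p) \<longleftrightarrow> [dot ?a u = - m] (mod p)" for u
    proof -
      have "sum_sq (add_scaled n w u) - t = (sum_sq w - t) + 2 * n * dot w u + n\<^sup>2 * sum_sq u"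
        by (simp add: sum_sq_add_scaled)
      also have "\<dots> = n * (m + 2 * dot w u + n * sum_sq u)"
        unfolding m by (simp add: algebra_simps power2_eq_square)
      also have "2 * dot w u = dot ?a u"
        by (cases u) (simp add: w_eq dot_def)
      finally have "[sum_sq (add_scaled n w u) = t] (mod n * p) \<longleftrightarrow> p dvd m + dot ?a u + n * sum_sq u"
        using \<open>n > 0\<close> by (simp add: cong_iff_dvd_diff)
      also have "\<dots> \<longleftrightarrow> p dvd m + dot ?a u" using \<open>p dvd n\<close> by (simp add: dvd_add_left_iff)
      finally show ?thesis by (simp add: cong_iff_dvd_diff add.commute)
    qed
    then have "?F = {u \<in> box p. [dot ?a u = - m] (mod p)}"
      using prim all_dvd_add_scaled[OF \<open>p dvd n\<close>] by auto
    moreover have "\<not> all_dvd p ?a"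
      using prim odd p by (auto simp: w_eq all_dvd_def prime_dvd_mult_iff)
    ultimately show ?thesis using True card_plane[OF p] by simp
  next
    case False
    have "w \<in> primitive_sols p n t"
      if "[sum_sq (add_scaled n w u) = t] (mod n * p)" and "\<not> all_dvd p (add_scaled n w u)" for u
    proof -
      have "[sum_sq (add_scaled n w u) = t] (mod n)" using that(1) by (rule cong_modulus_mult)
      then have "[sum_sq w = t] (mod n)"
        using cong_sum_sq_add_scaled cong_sym cong_trans by blast
      then show ?thesis using that(2) w all_dvd_add_scaled[OF \<open>p dvd n\<close>]
        by (simp add: primitive_sols_def sols_def)
    qed
    then have "?F = {}" using False by auto
    then show ?thesis using False by (simp only: card.empty) simp
  qed
  have "primitive_sols p (n * p) t =
      {v \<in> box (n * p). [sum_sq v = t] (mod n * p) \<and> \<not> all_dvd p v}"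
    by (auto simp: primitive_sols_def sols_def)
  then have "int (card (primitive_sols p (n * p) t)) =
      (\<Sum>w\<in>box n. if w \<in> primitive_sols p n t then p\<^sup>2 else 0)"
    using \<open>n > 0\<close> p0 fibre by (simp add: card_box_mult)
  also have "\<dots> = (\<Sum>w\<in>primitive_sols p n t. p\<^sup>2)"
    by (intro sum.mono_neutral_cong_right) (auto simp: primitive_sols_def sols_def)
  finally show ?thesis by simp
qed

lemma card_primitive_sols_power:
  assumes p: "prime p" and odd: "\<not> p dvd 2"
  shows "int (card (primitive_sols p (p ^ Suc j) t)) = p ^ (2 * j) * int (card (primitive_sols p p t))"
proof (induction j)
  case (Suc j)
  have "int (card (primitive_sols p (p ^ Suc (Suc j)) t)) =
      p\<^sup>2 * int (card (primitive_sols p (p ^ Suc j) t))"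
    using card_primitive_sols_lift[OF p odd, of "p ^ Suc j" t] prime_gt_0_int[OF p]
    by (simp add: mult.commute mult.left_commute)
  then show ?case using Suc by (simp add: power2_eq_square)
qed simp

text \<open>A solution divisible by \<open>p\<close> is \<open>p * w\<close> with \<open>p\<^sup>2 * \<bar>w\<bar>\<^sup>2 = p\<^sup>2 * s\<close> modulo \<open>p\<^sup>2 * n\<close>. Here \<open>w\<close>
  is a vector modulo \<open>p * n\<close> subject to a condition modulo \<open>n\<close> only, hence the factor \<open>p\<^sup>3\<close>.\<close>

lemma card_imprimitive_sols:
  assumes p: "p > 0" and n: "n > 0"
  shows "int (card {v \<in> sols (p\<^sup>2 * n) (p\<^sup>2 * s). all_dvd p v}) = p ^ 3 * int (card (sols n s))"
proof -
  let ?f = "\<lambda>(x, y, z). (p * x, p * y, p * z)"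
  have sq: "sum_sq (?f w) = p\<^sup>2 * sum_sq w" for w
    by (cases w) (simp add: sum_sq_def power_mult_distrib distrib_left)
  have cong: "[p\<^sup>2 * x = p\<^sup>2 * s] (mod p\<^sup>2 * n) \<longleftrightarrow> [x = s] (mod n)" for x
    using p by (simp add: cong_iff_dvd_diff flip: right_diff_distrib)
  have "{v \<in> sols (p\<^sup>2 * n) (p\<^sup>2 * s). all_dvd p v} =
      ?f ` {w \<in> box (n * p). [sum_sq w = s] (mod n)}" (is "?L = ?R")
  proof
    show "?R \<subseteq> ?L"
    proof (rule image_subsetI)
      fix w assume w: "w \<in> {w \<in> box (n * p). [sum_sq w = s] (mod n)}"
      have "?f w \<in> box (p\<^sup>2 * n)" and "all_dvd p (?f w)"
        using w p by (auto simp: box_def all_dvd_def power2_eq_square mult.assoc mult.commute[of n])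
      then show "?f w \<in> ?L" using w by (simp only: sols_def mem_Collect_eq sq cong)
    qed
    show "?L \<subseteq> ?R"
    proof
      fix v assume v: "v \<in> ?L"
      obtain x' y' z' where "v = (x', y', z')" by (cases v)
      then obtain x y z where v_eq: "v = ?f (x, y, z)"
        using v by (auto simp: all_dvd_def elim!: dvdE)
      have "(x, y, z) \<in> {w \<in> box (n * p). [sum_sq w = s] (mod n)}"
        using v p unfolding v_eq sols_def
        by (auto simp only: mem_Collect_eq sq cong)
           (auto simp: box_def power2_eq_square zero_le_mult_iff mult.assoc mult.commute[of n])
      then show "v \<in> ?R" unfolding v_eq by (rule imageI)
    qed
  qed
  moreover have "inj ?f" using p by (auto simp: inj_def)
  ultimately have "card {v \<in> sols (p\<^sup>2 * n) (p\<^sup>2 * s). all_dvd p v} =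
      card {w \<in> box (n * p). [sum_sq w = s] (mod n)}"
    by (simp add: card_image inj_on_subset)
  also have "\<dots> = (\<Sum>w\<in>box n. card {u \<in> box p. [sum_sq (add_scaled n w u) = s] (mod n)})"
    using p n by (simp add: card_box_mult)
  also have "\<dots> = (\<Sum>w\<in>box n. if [sum_sq w = s] (mod n) then card (box p) else 0)"
  proof (intro sum.cong refl)
    fix w
    have "[sum_sq (add_scaled n w u) = s] (mod n) \<longleftrightarrow> [sum_sq w = s] (mod n)" for u
      using cong_sum_sq_add_scaled cong_sym cong_trans by blast
    then show "card {u \<in> box p. [sum_sq (add_scaled n w u) = s] (mod n)} =
        (if [sum_sq w = s] (mod n) then card (box p) else 0)" by simp
  qed
  also have "\<dots> = card (sols n s) * card (box p)"
    by (simp add: sols_def flip: sum.inter_filter)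
  finally show ?thesis using p by (simp add: card_box)
qed

lemma card_sols_split:
  "card (sols n t) = card (primitive_sols p n t) + card {v \<in> sols n t. all_dvd p v}"
proof -
  have "sols n t = primitive_sols p n t \<union> {v \<in> sols n t. all_dvd p v}"
    by (auto simp: primitive_sols_def)
  then show ?thesis
    by (metis (no_types, lifting) card_Un_disjoint disjoint_iff finite_sols finite_subset
        mem_Collect_eq primitive_sols_def sup_ge2)
qed

section \<open>Sums of two squares modulo a prime congruent to 3 modulo 4\<close>

locale prime_3_mod_4 =
  fixes p :: int
  assumes prime: "prime p" and mod4: "p mod 4 = 3"
begin

lemma gt_2: "p > 2"
proof -
  have "p \<ge> 2" using prime by (rule prime_ge_2_int)
  moreover have "p \<noteq> 2" using mod4 by auto
  ultimately show ?thesis by simp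
qed

lemma not_dvd_2: "\<not> p dvd 2"
  using gt_2 zdvd_imp_le by fastforce

lemma inverse_mod:
  assumes "\<not> p dvd a"
  obtains b where "[a * b = 1] (mod p)" and "\<not> p dvd b"
proof -
  have "coprime a p"
    using prime assms by (metis prime_imp_coprime coprime_commute)
  then obtain b where b: "[a * b = 1] (mod p)"
    using cong_solve_coprime_int by blast
  moreover have "\<not> p dvd b"
    using b gt_2 by (metis cong_dvd_iff dvd_mult zdvd_not_zless less_trans one_less_numeral_iff
        semiring_norm(76) zero_less_one)
  ultimately show ?thesis using that by blast
qed

lemma Legendre_cong_power: "[Legendre a p = a ^ ((nat p - 1) div 2)] (mod p)"
  using euler_criterion[of "nat p" a] prime gt_2 by simp

text \<open>By Euler's criterion, since \<open>(p - 1) / 2\<close> is odd. Everything below that is special to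
  \<open>p \<equiv> 3\<close> modulo \<open>4\<close> comes from this fact: it makes \<open>x\<^sup>2 + y\<^sup>2\<close> an anisotropic form modulo \<open>p\<close>.\<close>

lemma neg_one_not_QuadRes: "\<not> QuadRes p (- 1)"
proof -
  have "odd ((n - 1) div 2)" if "n mod 4 = 3" for n :: nat using that by presburger
  moreover have "nat p mod 4 = 3" using nat_mod_distrib[of p 4] mod4 gt_2 by simp
  ultimately have "odd ((nat p - 1) div 2)" .
  then have "[Legendre (- 1) p = - 1] (mod p)"
    using Legendre_cong_power[of "- 1"] by simp
  moreover have "\<not> [1 = - 1 :: int] (mod p)"
    using not_dvd_2 by (simp add: cong_iff_dvd_diff)
  moreover have "\<not> [- 1 = 0] (mod p)"
    using gt_2 by (simp add: cong_0_iff)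
  ultimately show ?thesis by (auto simp: Legendre_def)
qed

text \<open>If \<open>x\<close> were a unit modulo \<open>p\<close>, then \<open>y / x\<close> would be a square root of \<open>-1\<close>.\<close>

lemma dvd_sum_two_squares:
  assumes "p dvd x\<^sup>2 + y\<^sup>2"
  shows "p dvd x \<and> p dvd y"
proof -
  have x: "p dvd x"
  proof (rule ccontr)
    assume "\<not> p dvd x"
    then obtain i where i: "[x * i = 1] (mod p)" by (rule inverse_mod)
    have "[(x * i)\<^sup>2 = 1\<^sup>2] (mod p)" using i by (rule cong_pow)
    moreover have "p dvd (x\<^sup>2 + y\<^sup>2) * i\<^sup>2" using assms by simp
    ultimately have "p dvd (x\<^sup>2 + y\<^sup>2) * i\<^sup>2 - ((x * i)\<^sup>2 - 1\<^sup>2)"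
      unfolding cong_iff_dvd_diff by (rule dvd_diff[rotated])
    also have "(x\<^sup>2 + y\<^sup>2) * i\<^sup>2 - ((x * i)\<^sup>2 - 1\<^sup>2) = (y * i)\<^sup>2 - (- 1)"
      by (simp add: algebra_simps power_mult_distrib)
    finally have "[(y * i)\<^sup>2 = - 1] (mod p)" unfolding cong_iff_dvd_diff .
    then show False using neg_one_not_QuadRes unfolding QuadRes_def by blast
  qed
  then have "p dvd x\<^sup>2" by (simp add: power2_eq_square)
  then have "p dvd y\<^sup>2" using assms dvd_add_right_iff by blast
  then show ?thesis using x prime prime_dvd_power by blast
qed

lemma Legendre_mult: "Legendre (a * b) p = Legendre a p * Legendre b p"
proof -
  let ?h = "(nat p - 1) div 2"
  have "[Legendre (a * b) p = (a * b) ^ ?h] (mod p)"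
    by (rule Legendre_cong_power)
  also have "(a * b) ^ ?h = a ^ ?h * b ^ ?h" by (simp add: power_mult_distrib)
  also have "[a ^ ?h * b ^ ?h = Legendre a p * Legendre b p] (mod p)"
    by (intro cong_mult cong_sym[OF Legendre_cong_power])
  finally have "p dvd Legendre (a * b) p - Legendre a p * Legendre b p"
    by (simp add: cong_iff_dvd_diff)
  \<comment> \<open>Both sides lie in \<open>{-1, 0, 1}\<close> and \<open>p > 2\<close>, so congruence forces equality.\<close>
  moreover have "\<bar>Legendre (a * b) p - Legendre a p * Legendre b p\<bar> \<le> 2"
    by (auto simp: Legendre_def)
  ultimately have "Legendre (a * b) p - Legendre a p * Legendre b p = 0"
    using gt_2 dvd_imp_le_int[of "Legendre (a * b) p - Legendre a p * Legendre b p" p] by linarith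
  then show ?thesis by simp
qed

text \<open>Let \<open>r\<close> be the least natural number that is not a square modulo \<open>p\<close>; then \<open>r - 1\<close> is a
  square, so \<open>r = s\<^sup>2 + 1\<close>. Any other non-residue differs from \<open>r\<close> by a square factor.\<close>

lemma unit_sum_two_squares:
  assumes "\<not> p dvd c"
  obtains a b where "[a\<^sup>2 + b\<^sup>2 = c] (mod p)"
proof (cases "QuadRes p c")
  case True
  then obtain y where "[y\<^sup>2 + 0\<^sup>2 = c] (mod p)" by (auto simp: QuadRes_def)
  then show ?thesis by (rule that)
next
  case False
  define r where "r = (LEAST n. \<not> QuadRes p (int n))"
  have "[p - 1 = - 1] (mod p)" by (simp add: cong_iff_dvd_diff)
  then have "\<not> QuadRes p (int (nat (p - 1)))"
    using neg_one_not_QuadRes gt_2 by (auto simp: QuadRes_def intro: cong_trans)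
  then have r: "\<not> QuadRes p (int r)" unfolding r_def by (rule LeastI)
  have "QuadRes p 0" by (auto simp: QuadRes_def intro: exI[of _ 0])
  then have "r \<noteq> 0" using r by (metis of_nat_0)
  then obtain m where m: "r = Suc m" by (cases r) auto
  then have "QuadRes p (int m)" using not_less_Least[of m "\<lambda>n. \<not> QuadRes p (int n)"]
    unfolding r_def by auto
  then obtain s where "[s\<^sup>2 = int m] (mod p)" by (auto simp: QuadRes_def)
  then have s: "[s\<^sup>2 + 1 = int r] (mod p)" using m by (simp add: cong_iff_dvd_diff)
  have rp: "\<not> p dvd int r"
    using r unfolding QuadRes_def by (metis cong_0_iff cong_sym zero_power2)
  have "Legendre c p = - 1" "Legendre (int r) p = - 1"
    using False r rp assms by (simp_all add: Legendre_def cong_0_iff)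
  then have "Legendre (c * int r) p = 1" by (simp add: Legendre_mult)
  then obtain y where y: "[y\<^sup>2 = c * int r] (mod p)"
    by (auto simp: Legendre_def QuadRes_def split: if_splits)
  obtain i where i: "[int r * i = 1] (mod p)" using rp by (rule inverse_mod)
  have "(s * y * i)\<^sup>2 + (y * i)\<^sup>2 = (s\<^sup>2 + 1) * (y\<^sup>2 * i\<^sup>2)"
    by (simp add: algebra_simps power2_eq_square)
  also have "[\<dots> = int r * ((c * int r) * i\<^sup>2)] (mod p)"
    using s y by (intro cong_mult cong_refl)
  also have "int r * ((c * int r) * i\<^sup>2) = c * (int r * i)\<^sup>2"
    by (simp add: algebra_simps power2_eq_square)
  also have "[\<dots> = c * 1\<^sup>2] (mod p)" using i by (intro cong_mult cong_refl cong_pow)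
  finally show ?thesis using that by simp
qed

definition two_square_sols :: "int \<Rightarrow> (int \<times> int) set" where
  "two_square_sols c = {(x, y) \<in> {0..<p} \<times> {0..<p}. [x\<^sup>2 + y\<^sup>2 = c] (mod p)}"

lemma finite_two_square_sols [simp]: "finite (two_square_sols c)"
  by (rule finite_subset[of _ "{0..<p} \<times> {0..<p}"]) (auto simp: two_square_sols_def)

lemma two_square_sols_0:
  assumes "p dvd c"
  shows "two_square_sols c = {(0, 0)}"
proof -
  have "(x, y) = (0, 0)" if "(x, y) \<in> two_square_sols c" for x y
  proof -
    have "p dvd x\<^sup>2 + y\<^sup>2"
      using that assms by (auto simp: two_square_sols_def cong_dvd_iff)
    then have "p dvd x \<and> p dvd y" by (rule dvd_sum_two_squares)
    then show ?thesis using that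
      by (auto simp: two_square_sols_def zdvd_not_zless order_le_less)
  qed
  moreover have "(0, 0) \<in> two_square_sols c"
    using assms gt_2 by (auto simp: two_square_sols_def cong_iff_dvd_diff)
  ultimately show ?thesis by auto
qed

text \<open>Multiplication by the Gaussian integer \<open>a + b \<i>\<close> multiplies the norm \<open>x\<^sup>2 + y\<^sup>2\<close> by \<open>a\<^sup>2 + b\<^sup>2\<close>,
  and it is injective modulo \<open>p\<close> because \<open>a\<^sup>2 + b\<^sup>2\<close> is a unit.\<close>

lemma card_two_square_sols_le:
  assumes "\<not> p dvd a\<^sup>2 + b\<^sup>2" and "[d = c * (a\<^sup>2 + b\<^sup>2)] (mod p)"
  shows "card (two_square_sols c) \<le> card (two_square_sols d)"
proof (rule card_inj_on_le)
  let ?f = "\<lambda>(x, y). ((a * x - b * y) mod p, (a * y + b * x) mod p)"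
  show "inj_on ?f (two_square_sols c)"
  proof (rule inj_onI, clarify)
    fix x y u v
    assume xy: "(x, y) \<in> two_square_sols c" and uv: "(u, v) \<in> two_square_sols c"
      and "(a * x - b * y) mod p = (a * u - b * v) mod p"
          "(a * y + b * x) mod p = (a * v + b * u) mod p"
    then have *: "p dvd (a * x - b * y) - (a * u - b * v)" "p dvd (a * y + b * x) - (a * v + b * u)"
      by (simp_all add: mod_eq_dvd_iff)
    have "p dvd a * ((a * x - b * y) - (a * u - b * v)) + b * ((a * y + b * x) - (a * v + b * u))"
      using * by simp
    also have "\<dots> = (a\<^sup>2 + b\<^sup>2) * (x - u)" by (simp add: algebra_simps power2_eq_square)
    finally have 1: "p dvd x - u" using assms(1) prime by (simp add: prime_dvd_mult_iff)
    have "p dvd a * ((a * y + b * x) - (a * v + b * u)) - b * ((a * x - b * y) - (a * u - b * v))"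
      using * by simp
    also have "\<dots> = (a\<^sup>2 + b\<^sup>2) * (y - v)" by (simp add: algebra_simps power2_eq_square)
    finally have 2: "p dvd y - v" using assms(1) prime by (simp add: prime_dvd_mult_iff)
    show "x = u \<and> y = v"
      using xy uv 1 2 cong_less_imp_eq_int[of x p u] cong_less_imp_eq_int[of y p v]
      by (auto simp: two_square_sols_def cong_iff_dvd_diff)
  qed
  show "?f ` two_square_sols c \<subseteq> two_square_sols d"
  proof clarify
    fix x y assume "(x, y) \<in> two_square_sols c"
    then have "[x\<^sup>2 + y\<^sup>2 = c] (mod p)" by (simp add: two_square_sols_def)
    then have "[(x\<^sup>2 + y\<^sup>2) * (a\<^sup>2 + b\<^sup>2) = d] (mod p)"
      using assms(2) by (metis cong_scalar_right cong_sym cong_trans)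
    moreover have "(x\<^sup>2 + y\<^sup>2) * (a\<^sup>2 + b\<^sup>2) = (a * x - b * y)\<^sup>2 + (a * y + b * x)\<^sup>2"
      by (simp add: algebra_simps power2_eq_square)
    moreover have "[((a * x - b * y) mod p)\<^sup>2 + ((a * y + b * x) mod p)\<^sup>2 =
        (a * x - b * y)\<^sup>2 + (a * y + b * x)\<^sup>2] (mod p)"
      by (intro cong_add cong_pow) auto
    ultimately show "((a * x - b * y) mod p, (a * y + b * x) mod p) \<in> two_square_sols d"
      using gt_2 by (auto simp: two_square_sols_def intro: cong_trans)
  qed
qed simp

text \<open>The quotient of two units is again a unit, hence a norm.\<close>

lemma card_two_square_sols_eq:
  assumes "\<not> p dvd c" and "\<not> p dvd d"
  shows "card (two_square_sols c) = card (two_square_sols d)"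
proof -
  have "card (two_square_sols c) \<le> card (two_square_sols d)"
    if c: "\<not> p dvd c" and d: "\<not> p dvd d" for c d
  proof -
    obtain i where i: "[c * i = 1] (mod p)" "\<not> p dvd i" using c by (rule inverse_mod)
    have di: "\<not> p dvd d * i" using d i prime by (simp add: prime_dvd_mult_iff)
    then obtain a b where ab: "[a\<^sup>2 + b\<^sup>2 = d * i] (mod p)" by (rule unit_sum_two_squares)
    show ?thesis
    proof (rule card_two_square_sols_le)
      show "\<not> p dvd a\<^sup>2 + b\<^sup>2" using ab di by (simp add: cong_dvd_iff)
      have "[c * (a\<^sup>2 + b\<^sup>2) = c * (d * i)] (mod p)" using ab by (rule cong_scalar_left)
      also have "c * (d * i) = d * (c * i)" by simp
      also have "[d * (c * i) = d * 1] (mod p)" using i by (intro cong_scalar_left)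
      finally show "[d = c * (a\<^sup>2 + b\<^sup>2)] (mod p)" by (simp add: cong_sym)
    qed
  qed
  then show ?thesis using assms by (metis le_antisym)
qed

text \<open>The \<open>p\<^sup>2 - 1\<close> nonzero pairs are shared equally among the \<open>p - 1\<close> nonzero values.\<close>

lemma card_two_square_sols_unit:
  assumes "\<not> p dvd c"
  shows "int (card (two_square_sols c)) = p + 1"
proof -
  let ?N = "card (two_square_sols c)"
  have "card ({0..<p} \<times> {0..<p}) =
      (\<Sum>d\<in>{0..<p}. card {v \<in> {0..<p} \<times> {0..<p}. [(fst v)\<^sup>2 + (snd v)\<^sup>2 = d] (mod p)})"
    using gt_2 by (intro card_eq_sum_residues) auto
  also have "\<dots> = (\<Sum>d\<in>{0..<p}. card (two_square_sols d))"
    by (intro sum.cong refl arg_cong[where f = card]) (auto simp: two_square_sols_def)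
  also have "\<dots> = (\<Sum>d\<in>insert 0 {1..<p}. card (two_square_sols d))"
    using gt_2 by (intro sum.cong) auto
  also have "\<dots> = 1 + (\<Sum>d\<in>{1..<p}. card (two_square_sols d))"
    by (simp add: two_square_sols_0)
  also have "(\<Sum>d\<in>{1..<p}. card (two_square_sols d)) = (\<Sum>d\<in>{1..<p}. ?N)"
    using assms by (intro sum.cong card_two_square_sols_eq) (auto simp: zdvd_not_zless)
  finally have "nat p * nat p = 1 + (nat p - 1) * ?N"
    using gt_2 by (simp add: card_cartesian_product nat_diff_distrib)
  then have "int (nat p * nat p) = int (1 + (nat p - 1) * ?N)" by simp
  then have "p * p = 1 + (p - 1) * int ?N" using gt_2 by (simp add: of_nat_diff)
  then have "(p - 1) * (p + 1) = (p - 1) * int ?N" by (simp add: algebra_simps)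
  then show ?thesis using gt_2 by simp
qed

lemma card_square_roots:
  "int (card {z \<in> {0..<p}. [z\<^sup>2 = c] (mod p)}) = 1 + Legendre c p"
proof (cases "QuadRes p c")
  case False
  then have "{z \<in> {0..<p}. [z\<^sup>2 = c] (mod p)} = {}" by (auto simp: QuadRes_def)
  moreover have "\<not> [c = 0] (mod p)"
    using False unfolding QuadRes_def by (metis cong_sym zero_power2)
  ultimately show ?thesis using False by (simp only: Legendre_def) simp
next
  case True
  then obtain y where y: "[y\<^sup>2 = c] (mod p)" by (auto simp: QuadRes_def)
  have *: "[z\<^sup>2 = c] (mod p) \<longleftrightarrow> [z = y] (mod p) \<or> [z = - y] (mod p)" for z
  proof -
    have "[z\<^sup>2 = c] (mod p) \<longleftrightarrow> [z\<^sup>2 = y\<^sup>2] (mod p)" using y by (metis cong_sym cong_trans)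
    also have "\<dots> \<longleftrightarrow> p dvd (z - y) * (z + y)"
      by (simp add: cong_iff_dvd_diff algebra_simps power2_eq_square)
    finally show ?thesis using prime by (simp add: prime_dvd_mult_iff cong_iff_dvd_diff)
  qed
  have "{z \<in> {0..<p}. [z\<^sup>2 = c] (mod p)} = {y mod p, (- y) mod p}"
    unfolding * using gt_2 by (auto simp: cong_def)
  moreover have "y mod p = (- y) mod p \<longleftrightarrow> [c = 0] (mod p)"
  proof -
    have "y mod p = (- y) mod p \<longleftrightarrow> p dvd 2 * y" by (simp add: mod_eq_dvd_iff)
    also have "\<dots> \<longleftrightarrow> p dvd y\<^sup>2"
      using prime not_dvd_2 by (simp add: prime_dvd_mult_iff prime_dvd_power_iff)
    also have "\<dots> \<longleftrightarrow> [c = 0] (mod p)" using y by (simp add: cong_dvd_iff cong_0_iff)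
    finally show ?thesis .
  qed
  ultimately show ?thesis using True by (simp add: Legendre_def card_insert_if)
qed

section \<open>Sums of three squares modulo prime powers\<close>

text \<open>Fix \<open>x\<close> and count \<open>y\<^sup>2 + z\<^sup>2 = t - x\<^sup>2\<close>: there are \<open>p + 1\<close> solutions, except for the
  \<open>1 + Legendre t p\<close> values of \<open>x\<close> with \<open>x\<^sup>2 = t\<close>, which leave only \<open>y = z = 0\<close>.\<close>

lemma card_sols_prime: "int (card (sols p t)) = p\<^sup>2 - Legendre t p * p"
proof -
  have "sols p t = (SIGMA x:{0..<p}. two_square_sols (t - x\<^sup>2))"
    by (auto simp: sols_def box_def sum_sq_def two_square_sols_def cong_iff_dvd_diff algebra_simps)
  then have "int (card (sols p t)) = (\<Sum>x\<in>{0..<p}. int (card (two_square_sols (t - x\<^sup>2))))"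
    by (simp add: card_SigmaI)
  also have "\<dots> = (\<Sum>x\<in>{0..<p}. (p + 1) - (if [x\<^sup>2 = t] (mod p) then p else 0))"
  proof (intro sum.cong refl)
    fix x
    have "[x\<^sup>2 = t] (mod p) \<longleftrightarrow> p dvd t - x\<^sup>2"
      by (simp add: cong_iff_dvd_diff dvd_diff_commute)
    then show "int (card (two_square_sols (t - x\<^sup>2))) =
        (p + 1) - (if [x\<^sup>2 = t] (mod p) then p else 0)"
      by (simp add: two_square_sols_0 card_two_square_sols_unit)
  qed
  also have "\<dots> = p * (p + 1) - int (card {x \<in> {0..<p}. [x\<^sup>2 = t] (mod p)}) * p"
    using gt_2 by (simp add: sum_subtractf flip: sum.inter_filter)
  also have "\<dots> = p\<^sup>2 - Legendre t p * p"
    by (simp only: card_square_roots) (simp add: algebra_simps power2_eq_square)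
  finally show ?thesis .
qed

lemma card_primitive_sols_prime:
  "int (card (primitive_sols p p t)) = (if p dvd t then p\<^sup>2 - 1 else p\<^sup>2 - Legendre t p * p)"
proof -
  have zero: "v = (0, 0, 0)" if "v \<in> box p" "all_dvd p v" for v
  proof -
    have "x = 0" if "p dvd x" "x \<in> {0..<p}" for x
      using that zdvd_not_zless[of x p] by fastforce
    then show ?thesis using that by (cases v) (auto simp: box_def all_dvd_def)
  qed
  have mem: "(0, 0, 0) \<in> sols p t \<longleftrightarrow> p dvd t"
    using gt_2 by (simp add: sols_def box_def sum_sq_def cong_iff_dvd_diff)
  have "all_dvd p (0, 0, 0)" by (simp add: all_dvd_def)
  then have "{v \<in> sols p t. all_dvd p v} = {v. v = (0, 0, 0) \<and> v \<in> sols p t}"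
    using zero unfolding sols_def by blast
  also have "\<dots> = (if p dvd t then {(0, 0, 0)} else {})" using mem by auto
  finally have "{v \<in> sols p t. all_dvd p v} = (if p dvd t then {(0, 0, 0)} else {})" .
  then have "card (sols p t) = card (primitive_sols p p t) + (if p dvd t then 1 else 0)"
    using card_sols_split[of p t p] by simp
  moreover have "p dvd t \<Longrightarrow> Legendre t p = 0" by (simp add: Legendre_def cong_0_iff)
  ultimately show ?thesis using card_sols_prime[of t] by (auto split: if_splits)
qed

lemma all_dvd_imp_dvd_sum_sq: "all_dvd p v \<Longrightarrow> p\<^sup>2 dvd sum_sq v"
  by (cases v) (auto simp: all_dvd_def sum_sq_def intro!: dvd_add dvd_power_same)

text \<open>Applied with \<open>q = p\<close> when \<open>t\<close> is a unit and with \<open>q = p\<^sup>2\<close> when \<open>p\<close> divides \<open>t\<close> exactly once.\<close>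

lemma sols_eq_primitive_sols:
  assumes "q dvd n" and "q dvd p\<^sup>2" and "\<not> q dvd t"
  shows "sols n t = primitive_sols p n t"
proof -
  have "\<not> all_dvd p v" if "v \<in> sols n t" for v
  proof
    assume "all_dvd p v"
    then have "q dvd sum_sq v" using all_dvd_imp_dvd_sum_sq assms(2) dvd_trans by blast
    moreover have "[sum_sq v = t] (mod q)"
      using that assms(1) cong_dvd_modulus by (auto simp: sols_def)
    ultimately show False using assms(3) cong_dvd_iff by blast
  qed
  then show ?thesis by (auto simp: primitive_sols_def)
qed

lemma card_sols_unit:
  assumes "\<not> p dvd t"
  shows "int (card (sols (p ^ Suc j) t)) = p ^ (2 * j) * (p\<^sup>2 - Legendre t p * p)"
proof -
  have "sols (p ^ Suc j) t = primitive_sols p (p ^ Suc j) t"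
    using assms by (intro sols_eq_primitive_sols[of p]) (auto simp: power2_eq_square)
  then show ?thesis
    using assms card_primitive_sols_power[OF prime not_dvd_2, of j t]
    by (simp add: card_primitive_sols_prime)
qed

lemma card_sols_exact_multiple:
  assumes "\<not> p dvd \<beta>"
  shows "int (card (sols (p ^ (j + 2)) (p * \<beta>))) = p ^ (2 * j + 2) * (p\<^sup>2 - 1)"
proof -
  have "\<not> p\<^sup>2 dvd p * \<beta>" using assms gt_2 by (simp add: power2_eq_square)
  then have "sols (p ^ (j + 2)) (p * \<beta>) = primitive_sols p (p ^ (j + 2)) (p * \<beta>)"
    by (intro sols_eq_primitive_sols[of "p\<^sup>2"]) (simp_all add: power2_eq_square)
  then show ?thesis
    using card_primitive_sols_power[OF prime not_dvd_2, of "Suc j" "p * \<beta>"]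
    by (simp add: card_primitive_sols_prime power2_eq_square)
qed

text \<open>The recursion behind the theorem: \<open>p\<^sup>2 - 1\<close> is the number of nonzero solutions of
  \<open>\<bar>v\<bar>\<^sup>2 = 0\<close> modulo \<open>p\<close>, which lift to the primitive solutions, and the second term counts the others.\<close>

lemma card_sols_descent:
  "int (card (sols (p ^ (j + 2)) (p\<^sup>2 * s))) =
     p ^ (2 * j + 2) * (p\<^sup>2 - 1) + p ^ 3 * int (card (sols (p ^ j) s))"
proof -
  have "int (card (primitive_sols p (p ^ (j + 2)) (p\<^sup>2 * s))) = p ^ (2 * j + 2) * (p\<^sup>2 - 1)"
    using card_primitive_sols_power[OF prime not_dvd_2, of "Suc j" "p\<^sup>2 * s"]
    by (simp add: card_primitive_sols_prime power2_eq_square)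
  moreover have "p ^ (j + 2) = p\<^sup>2 * p ^ j" by (simp add: power2_eq_square)
  then have "int (card {v \<in> sols (p ^ (j + 2)) (p\<^sup>2 * s). all_dvd p v}) =
      p ^ 3 * int (card (sols (p ^ j) s))"
    using card_imprimitive_sols[of p "p ^ j" s] gt_2 by (simp only:) simp
  ultimately show ?thesis
    using card_sols_split[of "p ^ (j + 2)" "p\<^sup>2 * s" p] by simp
qed

text \<open>The solutions of the recursion are stated with \<open>k = \<alpha> + 1 + j\<close> and \<open>\<alpha> = 2 * a\<close> or
  \<open>\<alpha> = 2 * a + 1\<close>, so that no exponent involves a truncated subtraction or a division.\<close>

lemma card_sols_even_valuation:
  assumes "\<not> p dvd \<beta>"
  shows "int (card (sols (p ^ (2 * a + 1 + j)) (p ^ (2 * a) * \<beta>))) =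
    p ^ (4 * a + 1 + 2 * j) * (p + 1) - (1 + Legendre \<beta> p) * p ^ (3 * a + 1 + 2 * j)"
proof (induction a)
  case 0
  show ?case using card_sols_unit[OF assms, of j]
    by (simp add: power_mult power2_eq_square algebra_simps)
next
  case (Suc a)
  have "int (card (sols (p ^ (2 * Suc a + 1 + j)) (p ^ (2 * Suc a) * \<beta>))) =
      int (card (sols (p ^ ((2 * a + 1 + j) + 2)) (p\<^sup>2 * (p ^ (2 * a) * \<beta>))))"
    by (simp add: power2_eq_square algebra_simps)
  also have "\<dots> = p ^ (2 * (2 * a + 1 + j) + 2) * (p\<^sup>2 - 1) + p ^ 3 *
      (p ^ (4 * a + 1 + 2 * j) * (p + 1) - (1 + Legendre \<beta> p) * p ^ (3 * a + 1 + 2 * j))"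
    unfolding card_sols_descent Suc.IH ..
  also have "2 * (2 * a + 1 + j) + 2 = (4 * a + 1 + 2 * j) + 3" by simp
  also have "p ^ \<dots> * (p\<^sup>2 - 1) + p ^ 3 *
      (p ^ (4 * a + 1 + 2 * j) * (p + 1) - (1 + Legendre \<beta> p) * p ^ (3 * a + 1 + 2 * j)) =
      p ^ ((4 * a + 1 + 2 * j) + 4) * (p + 1) - (1 + Legendre \<beta> p) * p ^ ((3 * a + 1 + 2 * j) + 3)"
    unfolding power_add[of p "_ + 2 * j"] by (simp add: algebra_simps eval_nat_numeral)
  finally show ?case by (simp add: algebra_simps)
qed

lemma card_sols_odd_valuation:
  assumes "\<not> p dvd \<beta>"
  shows "int (card (sols (p ^ (2 * a + 2 + j)) (p ^ (2 * a + 1) * \<beta>))) =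
    (p ^ (4 * a + 3 + 2 * j) - p ^ (3 * a + 2 + 2 * j)) * (p + 1)"
proof (induction a)
  case 0
  show ?case using card_sols_exact_multiple[OF assms, of j]
    by (simp add: power_add eval_nat_numeral algebra_simps)
next
  case (Suc a)
  have "int (card (sols (p ^ (2 * Suc a + 2 + j)) (p ^ (2 * Suc a + 1) * \<beta>))) =
      int (card (sols (p ^ ((2 * a + 2 + j) + 2)) (p\<^sup>2 * (p ^ (2 * a + 1) * \<beta>))))"
    by (simp add: power2_eq_square algebra_simps)
  also have "\<dots> = p ^ (2 * (2 * a + 2 + j) + 2) * (p\<^sup>2 - 1) + p ^ 3 *
      ((p ^ (4 * a + 3 + 2 * j) - p ^ (3 * a + 2 + 2 * j)) * (p + 1))"
    unfolding card_sols_descent Suc.IH ..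
  also have "2 * (2 * a + 2 + j) + 2 = (4 * a + 3 + 2 * j) + 3" by simp
  also have "p ^ \<dots> * (p\<^sup>2 - 1) + p ^ 3 *
      ((p ^ (4 * a + 3 + 2 * j) - p ^ (3 * a + 2 + 2 * j)) * (p + 1)) =
      (p ^ ((4 * a + 3 + 2 * j) + 4) - p ^ ((3 * a + 2 + 2 * j) + 3)) * (p + 1)"
    unfolding power_add[of p "_ + 2 * j"] by (simp add: algebra_simps eval_nat_numeral)
  finally show ?case by (simp add: algebra_simps)
qed

lemma card_sols_zero_odd_power:
  "int (card (sols (p ^ (2 * a + 1)) 0)) = p ^ (4 * a + 2) + p ^ (4 * a + 1) - p ^ (3 * a + 1)"
proof (induction a)
  case 0
  show ?case using card_sols_prime[of 0] by (simp add: Legendre_def power2_eq_square)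
next
  case (Suc a)
  have "int (card (sols (p ^ (2 * Suc a + 1)) 0)) =
      int (card (sols (p ^ ((2 * a + 1) + 2)) (p\<^sup>2 * 0)))"
    by (simp add: algebra_simps)
  also have "\<dots> = p ^ (2 * (2 * a + 1) + 2) * (p\<^sup>2 - 1) +
      p ^ 3 * (p ^ (4 * a + 2) + p ^ (4 * a + 1) - p ^ (3 * a + 1))"
    unfolding card_sols_descent Suc.IH ..
  also have "\<dots> = p ^ (4 * Suc a + 2) + p ^ (4 * Suc a + 1) - p ^ (3 * Suc a + 1)"
    by (simp add: power_add power_mult eval_nat_numeral algebra_simps)
  finally show ?case .
qed

text \<open>The factor \<open>p\<close> on the left clears the exponents \<open>4 * a - 1\<close> and \<open>3 * a - 1\<close>, and it lets the
  induction start at \<open>a = 0\<close>, where the modulus is \<open>1\<close>.\<close>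

lemma card_sols_zero_even_power:
  "p * int (card (sols (p ^ (2 * a)) 0)) = p ^ (4 * a + 1) + p ^ (4 * a) - p ^ (3 * a)"
proof (induction a)
  case 0
  have "sols 1 0 = {(0, 0, 0)}" by (auto simp: sols_def box_def)
  then show ?case by simp
next
  case (Suc a)
  have "p * int (card (sols (p ^ (2 * Suc a)) 0)) =
      p * int (card (sols (p ^ (2 * a + 2)) (p\<^sup>2 * 0)))"
    by (simp add: algebra_simps)
  also have "\<dots> = p * p ^ (2 * (2 * a) + 2) * (p\<^sup>2 - 1) + p ^ 3 * (p * int (card (sols (p ^ (2 * a)) 0)))"
    unfolding card_sols_descent by (simp add: algebra_simps)
  also have "\<dots> = p * p ^ (2 * (2 * a) + 2) * (p\<^sup>2 - 1) +
      p ^ 3 * (p ^ (4 * a + 1) + p ^ (4 * a) - p ^ (3 * a))"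
    unfolding Suc.IH ..
  also have "\<dots> = p ^ (4 * Suc a + 1) + p ^ (4 * Suc a) - p ^ (3 * Suc a)"
    by (simp add: power_add power_mult eval_nat_numeral algebra_simps)
  finally show ?case .
qed

end

section \<open>The counting formula\<close>

theorem theorem1p12:
  fixes p k \<alpha> :: nat and t \<beta> :: int
  assumes "prime p" and "odd p" and "[p = 3] (mod 4)"
    and "k \<ge> 1"
    and "t \<in> carrier (residue_ring (int (p ^ k)))"
    and "t \<noteq> 0 \<Longrightarrow> t = int p ^ \<alpha> * \<beta> \<and> \<not> int p dvd \<beta> \<and> \<alpha> < k"
  shows "(t = 0 \<longrightarrow>
            int (N3 t (p ^ k)) =
              int p ^ (2 * k) + int p ^ (2 * k - 1) - int p ^ (nat \<lceil>3 * real k / 2\<rceil> - 1)) \<and>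
         (t \<noteq> 0 \<and> odd \<alpha> \<longrightarrow>
            int (N3 t (p ^ k)) =
              (int p ^ (2 * k - 1) - int p ^ (2 * k - (\<alpha> + 3) div 2)) * (int p + 1)) \<and>
         (t \<noteq> 0 \<and> even \<alpha> \<and> Legendre \<beta> (int p) = 1 \<longrightarrow>
            int (N3 t (p ^ k)) =
              int p ^ (2 * k - 1) * (int p + 1) - 2 * int p ^ (2 * k - 1 - \<alpha> div 2)) \<and>
         (t \<noteq> 0 \<and> even \<alpha> \<and> Legendre \<beta> (int p) = -1 \<longrightarrow>
            int (N3 t (p ^ k)) = int p ^ (2 * k - 1) * (int p + 1))"
proof -
  interpret prime_3_mod_4 "int p"
  proof
    show "prime (int p)" using assms(1) by simp
    show "int p mod 4 = 3" using assms(3) unfolding cong_def by presburger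
  qed
  have N3: "int (N3 t (p ^ k)) = int (card (sols (int p ^ k) t))"
    by (simp add: N3_eq_card_sols)
  have zero: "int (N3 t (p ^ k)) =
      int p ^ (2 * k) + int p ^ (2 * k - 1) - int p ^ (nat \<lceil>3 * real k / 2\<rceil> - 1)" if "t = 0"
  proof (cases "odd k")
    case True
    then obtain a where k: "k = 2 * a + 1" by (rule oddE)
    have "\<lceil>3 * real k / 2\<rceil> = int (3 * a + 2)" unfolding k by (rule ceiling_unique) auto
    then have "nat \<lceil>3 * real k / 2\<rceil> - 1 = 3 * a + 1" by simp
    moreover have "2 * k = 4 * a + 2" "2 * k - 1 = 4 * a + 1" using k by simp_all
    ultimately show ?thesis
      using card_sols_zero_odd_power[of a] unfolding N3 unfolding that k[symmetric] by simp
  next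
    case False
    then obtain a where k: "k = 2 * a" by auto
    have "\<lceil>3 * real k / 2\<rceil> = int (3 * a)" unfolding k by (rule ceiling_unique) auto
    then have "3 * a = Suc (nat \<lceil>3 * real k / 2\<rceil> - 1)" and "4 * a = Suc (2 * k - 1)"
      using k assms(4) by simp_all
    then have e: "int p ^ (4 * a) = int p * int p ^ (2 * k - 1)"
        "int p ^ (3 * a) = int p * int p ^ (nat \<lceil>3 * real k / 2\<rceil> - 1)"
      by (simp_all only: power_Suc)
    have "4 * a + 1 = Suc (2 * k)" using k by simp
    then have e': "int p ^ (4 * a + 1) = int p * int p ^ (2 * k)" by (simp only: power_Suc)
    have "int p * int (card (sols (int p ^ k) 0)) =
        int p * (int p ^ (2 * k) + int p ^ (2 * k - 1) - int p ^ (nat \<lceil>3 * real k / 2\<rceil> - 1))"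
      using card_sols_zero_even_power[of a] unfolding e e' k[symmetric] by (simp only: distrib_left right_diff_distrib)
    then show ?thesis using gt_2 unfolding N3 unfolding that by simp
  qed
  have nonzero: "int (N3 t (p ^ k)) = (if odd \<alpha>
      then (int p ^ (2 * k - 1) - int p ^ (2 * k - (\<alpha> + 3) div 2)) * (int p + 1)
      else int p ^ (2 * k - 1) * (int p + 1) -
        (1 + Legendre \<beta> (int p)) * int p ^ (2 * k - 1 - \<alpha> div 2))" if "t \<noteq> 0"
  proof -
    have t: "t = int p ^ \<alpha> * \<beta>" and \<beta>: "\<not> int p dvd \<beta>" and "\<alpha> < k" using assms(6) that by auto
    then obtain j where k: "k = \<alpha> + 1 + j" using less_iff_Suc_add by auto
    show ?thesis
    proof (cases "odd \<alpha>")
      case True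
      then obtain a where a: "\<alpha> = 2 * a + 1" by (rule oddE)
      have e: "k = 2 * a + 2 + j" "2 * k - 1 = 4 * a + 3 + 2 * j"
          "2 * k - (\<alpha> + 3) div 2 = 3 * a + 2 + 2 * j"
        using a k by simp_all
      show ?thesis unfolding N3 e(2,3) unfolding e(1) t a
        using card_sols_odd_valuation[OF \<beta>, of a j] by simp
    next
      case False
      then obtain a where a: "\<alpha> = 2 * a" by auto
      have e: "k = 2 * a + 1 + j" "2 * k - 1 = 4 * a + 1 + 2 * j"
          "2 * k - 1 - \<alpha> div 2 = 3 * a + 1 + 2 * j"
        using a k by simp_all
      show ?thesis unfolding N3 e(3) unfolding e(2) unfolding e(1) t a
        using card_sols_even_valuation[OF \<beta>, of a j] by simp
    qed
  qed
  show ?thesis using zero nonzero by auto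
qed

end
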